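(* For every $n\in\mathbb{N}_0$, $${}_{T}B_{n}^{(c,v)}(x,y,z;\lambda)=\sum_{r=0}^n\binom{n}{r}B_{n-r}^{(c,v)}(0,z;\lambda)\,T_{r}(x,y)$$ and $${}_{T}B_{n}^{(s,v)}(x,y,z;\lambda)=\sum_{r=0}^n\binom{n}{r}B_{n-r}^{(s,v)}(0,z;\lambda)\,T_{r}(x,y).$$
   Context: $\mathbb{N}_0=\{0,1,2,\dots\}$; $x,y,z$ are variables (taking complex values) and $\lambda\in\mathbb{C}\setminus\{0\}$. Let $\mathcal{U}(y,t)=\sum_{n\ge0}\mathcal{U}_n(y)\frac{t^n}{n!}$ be a power series in $t$ with coefficients depending on $y$ and $\mathcal{U}_0(y)\neq0$; the 2-variable general polynomials $T_n(x,y)$ are defined by $e^{xt}\mathcal{U}(y,t)=\sum_{n\ge0}T_n(x,y)\frac{t^n}{n!}$, with the normalization $T_0(x,y)=1$. The order $v$ is such that $\bigl(\frac{t}{\lambda e^t-1}\bigr)^v$ is a power series in $t$ ($v\in\mathbb{N}_0$ in general; $v\in\mathbb{C}$ allowed when $\lambda=1$, with the branch $1^v=1$ at $t=0$). The parametric kinds of generalized Apostol--Bernoulli polynomials are defined, as power series in $t$, by $$\Bigl(\frac{t}{\lambda e^t-1}\Bigr)^v e^{xt}\,\mathcal{U}(y,t)\cos(zt)=\sum_{n=0}^\infty {}_{T}B_{n}^{(c,v)}(x,y,z;\lambda)\frac{t^n}{n!},$$ $$\Bigl(\frac{t}{\lambda e^t-1}\Bigr)^v e^{xt}\,\mathcal{U}(y,t)\sin(zt)=\sum_{n=0}^\infty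 {}_{T}B_{n}^{(s,v)}(x,y,z;\lambda)\frac{t^n}{n!}.$$ The two-variable parametric Apostol--Bernoulli polynomials $B_n^{(c,v)}(x,y;\lambda)$ and $B_n^{(s,v)}(x,y;\lambda)$ are defined by $$\Bigl(\frac{t}{\lambda e^t-1}\Bigr)^v e^{xt}\cos(yt)=\sum_{n=0}^\infty B_n^{(c,v)}(x,y;\lambda)\frac{t^n}{n!},\qquad \Bigl(\frac{t}{\lambda e^t-1}\Bigr)^v e^{xt}\sin(yt)=\sum_{n=0}^\infty B_n^{(s,v)}(x,y;\lambda)\frac{t^n}{n!}.$$ *)

theory Defs
  imports Complex_Main "HOL-Computational_Algebra.Formal_Power_Series"
begin

definition egf :: "(nat \<Rightarrow> complex) \<Rightarrow> complex fps" where
  "egf a = Abs_fps (\<lambda>n. a n / fact n)"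

definition egf_coeff :: "complex fps \<Rightarrow> nat \<Rightarrow> complex" where
  "egf_coeff F n = fact n * fps_nth F n"

lemma egf_eq_iff: "F = egf a \<longleftrightarrow> a = egf_coeff F"
  by (auto simp: egf_def egf_coeff_def fps_eq_iff fun_eq_iff field_simps)

text \<open>The quotient is division of formal power series; for \<open>lam = 1\<close> it
  cancels the common factor \<open>t\<close>.\<close>

definition apostol_base :: "complex \<Rightarrow> complex fps" where
  "apostol_base lam = fps_X / (fps_const lam * fps_exp 1 - 1)"

text \<open>The power \<open>(t / (lam e\<^sup>t - 1))\<^sup>v\<close>. For \<open>lam = 1\<close> the base has constant term 1, and its
  power with arbitrary complex exponent is the binomial series
  \<open>(1 + (f - 1))\<^sup>v\<close>, i.e. the branch with value 1 at \<open>t = 0\<close>. For \<open>lam \<noteq> 1\<close> the base has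
  constant term 0 and only exponents in \<open>\<nat>\<close> are meaningful (other values are junk).
  On the overlap the two readings agree, see \<open>apostol_factor_of_nat\<close> below.\<close>

definition apostol_factor :: "complex \<Rightarrow> complex \<Rightarrow> complex fps" where
  "apostol_factor lam v =
     (if lam = 1 then fps_binomial v oo (apostol_base lam - 1)
      else apostol_base lam ^ (THE k. of_nat k = v))"

text \<open>The coefficients \<open>\<U>\<^sub>n\<close> of \<open>\<U>(y,t)\<close> are arbitrary functions \<open>U n\<close> of \<open>y\<close>.\<close>

definition gen_poly :: "(nat \<Rightarrow> complex \<Rightarrow> complex) \<Rightarrow> nat \<Rightarrow> complex \<Rightarrow> complex \<Rightarrow> complex" where
  "gen_poly U n x y = egf_coeff (fps_exp x * egf (\<lambda>k. U k y)) n"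

definition TB_cos ::
  "(nat \<Rightarrow> complex \<Rightarrow> complex) \<Rightarrow> complex \<Rightarrow> nat \<Rightarrow> complex \<Rightarrow> complex \<Rightarrow> complex \<Rightarrow> complex \<Rightarrow> complex" where
  "TB_cos U v n x y z lam =
     egf_coeff (apostol_factor lam v * fps_exp x * egf (\<lambda>k. U k y) * fps_cos z) n"

definition TB_sin ::
  "(nat \<Rightarrow> complex \<Rightarrow> complex) \<Rightarrow> complex \<Rightarrow> nat \<Rightarrow> complex \<Rightarrow> complex \<Rightarrow> complex \<Rightarrow> complex \<Rightarrow> complex" where
  "TB_sin U v n x y z lam =
     egf_coeff (apostol_factor lam v * fps_exp x * egf (\<lambda>k. U k y) * fps_sin z) n"

definition B_cos :: "complex \<Rightarrow> nat \<Rightarrow> complex \<Rightarrow> complex \<Rightarrow> complex \<Rightarrow> complex" where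
  "B_cos v n x y lam = egf_coeff (apostol_factor lam v * fps_exp x * fps_cos y) n"

definition B_sin :: "complex \<Rightarrow> nat \<Rightarrow> complex \<Rightarrow> complex \<Rightarrow> complex \<Rightarrow> complex" where
  "B_sin v n x y lam = egf_coeff (apostol_factor lam v * fps_exp x * fps_sin y) n"

lemma apostol_denom_nth:
  "fps_nth (fps_const lam * fps_exp 1 - 1 :: complex fps) n = (if n = 0 then lam - 1 else lam / fact n)"
  by simp

lemma apostol_base_mult:
  assumes "lam \<noteq> 0"
  shows "apostol_base lam * (fps_const lam * fps_exp 1 - 1) = fps_X"
proof -
  let ?g = "fps_const lam * fps_exp 1 - 1 :: complex fps"
  have g1: "fps_nth ?g 1 \<noteq> 0" 
    using assms by simp
  then have "?g \<noteq> 0" by (metis fps_zero_nth)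
  moreover have "subdegree ?g \<le> subdegree (fps_X :: complex fps)"
    using subdegree_leI[OF g1] by simp
  ultimately have "?g dvd fps_X" by (subst fps_dvd_iff) auto
  then show ?thesis unfolding apostol_base_def by (rule dvd_div_mult_self)
qed

lemma apostol_base_1_nth_0: "fps_nth (apostol_base 1) 0 = 1"
proof -
  have "fps_nth (apostol_base 1 * (fps_const 1 * fps_exp 1 - 1)) 1 = 1"
    by (subst apostol_base_mult) auto
  then show ?thesis by (simp add: fps_mult_nth)
qed

lemma apostol_factor_of_nat: "apostol_factor lam (of_nat k) = apostol_base lam ^ k"
proof (cases "lam = 1")
  case True
  have z: "fps_nth (apostol_base 1 - 1) 0 = 0"
    by (simp add: apostol_base_1_nth_0)
  have "fps_binomial (of_nat k) oo (apostol_base 1 - 1) = (1 + fps_X) ^ k oo (apostol_base 1 - 1)"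
    by (simp add: fps_binomial_of_nat)
  also have "\<dots> = ((1 + fps_X) oo (apostol_base 1 - 1)) ^ k"
    using z by (simp add: fps_compose_power)
  also have "\<dots> = apostol_base 1 ^ k"
    using z by (simp add: fps_compose_add_distrib)
  finally show ?thesis using True by (simp add: apostol_factor_def)
next
  case False
  then show ?thesis by (simp add: apostol_factor_def)
qed

end

theory Submission
  imports Defs
begin

text \<open>The generating function of the parametric polynomials factors as that of
  \<open>B_cos\<close> or \<open>B_sin\<close> at first argument 0, times that of
  \<open>gen_poly\<close>. Products of exponential generating functions have binomial convolutions
  as coefficients (\<open>egf_coeff_mult\<close>).\<close>

lemma egf_coeff_mult:
  "egf_coeff (F * G) n =
     (\<Sum>r=0..n. of_nat (n choose r) * egf_coeff F (n - r) * egf_coeff G r)"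
proof -
  \<comment> \<open>Commuting the product first lets the index \<open>r\<close> fall on
    \<open>G\<close>, as the theorem requires.\<close>
  have "egf_coeff (F * G) n = (\<Sum>r=0..n. fact n * (fps_nth G r * fps_nth F (n - r)))"
    by (simp add: egf_coeff_def mult.commute[of F] fps_mult_nth sum_distrib_left)
  also have "\<dots> = (\<Sum>r=0..n. of_nat (n choose r) * egf_coeff F (n - r) * egf_coeff G r)"
    by (intro sum.cong refl) (simp add: egf_coeff_def binomial_fact)
  finally show ?thesis .
qed

theorem theorem3p1:
  fixes U :: "nat \<Rightarrow> complex \<Rightarrow> complex" and x y z lam v :: complex and n :: nat
  assumes "lam \<noteq> 0"
    and "lam = 1 \<or> v \<in> \<nat>"
    and "\<And>y. U 0 y \<noteq> 0"
    and "\<And>x y. gen_poly U 0 x y = 1"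
  shows "TB_cos U v n x y z lam =
           (\<Sum>r=0..n. of_nat (n choose r) * B_cos v (n - r) 0 z lam * gen_poly U r x y)
       \<and> TB_sin U v n x y z lam =
           (\<Sum>r=0..n. of_nat (n choose r) * B_sin v (n - r) 0 z lam * gen_poly U r x y)"
proof -
  let ?A = "apostol_factor lam v" and ?V = "fps_exp x * egf (\<lambda>k. U k y)"
  \<comment> \<open>Since \<open>fps_exp 0 = 1\<close>, that factor can be inserted while
    \<open>fps_exp x\<close> moves to \<open>?V\<close>; \<open>S\<close> stands for
    \<open>fps_cos z\<close> or \<open>fps_sin z\<close>.\<close>
  have "?A * fps_exp x * egf (\<lambda>k. U k y) * S = (?A * fps_exp 0 * S) * ?V" for S
    by (simp add: mult_ac)
  then show ?thesis
    unfolding TB_cos_def TB_sin_def B_cos_def B_sin_def gen_poly_def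
    by (simp only: egf_coeff_mult[symmetric])
qed

end
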